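(* Let $K$ be a zerodimensional compact space such that the Boolean algebra $\mathfrak A=\mathrm{Clop}(K)$ of clopen subsets of $K$ has the approximation property. Then $K$ has the $^*$extension property.
   Context: Compact spaces are Hausdorff. For an algebra $\mathfrak A$ of subsets of a set $X$, $M(\mathfrak A)$ is the space of signed finitely additive functions $\mathfrak A\to\mathbb R$ of bounded variation, with $\|\mu\|=|\mu|(X)$, $|\mu|$ being the variation of $\mu$; $M_1(\mathfrak A)=\{\mu\in M(\mathfrak A):\|\mu\|\le 1\}$. For a finite subalgebra $\mathfrak B\subseteq\mathfrak A$ and real functions $\varphi,\psi$ defined on $\mathfrak B$, $\mathrm{dist}_{\mathfrak B}(\varphi,\psi)=\sup_{B\in\mathfrak B}|\varphi(B)-\psi(B)|$. The algebra $\mathfrak A$ has the approximation property if for any sequence of arbitrary functions $\varphi_n:\mathfrak A\to[-1,1]$ such that $\inf_{\mu\in M_1(\mathfrak A)}\mathrm{dist}_{\mathfrak B}(\mu,\varphi_n)\to0$ for every finite subalgebra $\mathfrak B\subseteq\mathfrak A$, there is a bounded sequence $(\nu_n)$ in $M(\mathfrak A)$ with $\varphi_n(a)-\nu_n(a)\to0$ for all $a\in\mathfrak A$. For compact $K$, $C(K)$ is the Banach space of continuous real-valued functions on $K$, and $C(K)^*$ is identified with the space $M(K)$ of signed Radon measures on $K$ of finite variation. $M_1(K)$ is the closed unit ball of $M(K)$ with the weak$^*$ topology; write $\nu(g)=\int g\,d\nu$. A compact space $L'\supseteq L$ is a countable discrete extension of a compact space $L$ if $L'\setminus L$ is countable and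 discrete. $K$ has the $^*$extension property if for every countable discrete extension $L'$ of $M_1(K)$ there is a bounded linear operator $E:C(K)\to C(L')$ such that $Eg(\nu)=\nu(g)$ for all $g\in C(K)$ and $\nu\in M_1(K)$. *)

theory Defs
  imports "HOL-Analysis.Analysis"
begin

section \<open>Finitely additive functions on an algebra of sets\<close>

definition variation :: "'a set set \<Rightarrow> ('a set \<Rightarrow> real) \<Rightarrow> 'a set \<Rightarrow> ennreal" where
  "variation \<AA> \<mu> A =
     (SUP P\<in>{P. finite P \<and> P \<subseteq> \<AA> \<and> partition_on A P}. \<Sum>B\<in>P. ennreal \<bar>\<mu> B\<bar>)"

text \<open>The values of a function outside \<open>\<AA>\<close> are never looked at in what follows, so the members of
  \<open>fa_measures X \<AA>\<close> are not normalised outside \<open>\<AA>\<close>.\<close>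

definition fa_measures :: "'a set \<Rightarrow> 'a set set \<Rightarrow> ('a set \<Rightarrow> real) set" where
  "fa_measures X \<AA> = {\<mu>. Measure_Space.additive \<AA> \<mu> \<and> variation \<AA> \<mu> X < \<infinity>}"

definition fa_ball :: "'a set \<Rightarrow> 'a set set \<Rightarrow> ('a set \<Rightarrow> real) set" where
  "fa_ball X \<AA> = {\<mu> \<in> fa_measures X \<AA>. variation \<AA> \<mu> X \<le> 1}"

definition dist_on :: "'a set set \<Rightarrow> ('a set \<Rightarrow> real) \<Rightarrow> ('a set \<Rightarrow> real) \<Rightarrow> real" where
  "dist_on \<BB> \<phi> \<psi> = (SUP B\<in>\<BB>. \<bar>\<phi> B - \<psi> B\<bar>)"

definition approximation_property :: "'a set \<Rightarrow> 'a set set \<Rightarrow> bool" where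
  "approximation_property X \<AA> \<longleftrightarrow>
     (\<forall>\<phi> :: nat \<Rightarrow> 'a set \<Rightarrow> real.
        (\<forall>n. \<forall>a\<in>\<AA>. \<phi> n a \<in> {-1..1}) \<longrightarrow>
        (\<forall>\<BB>. \<BB> \<subseteq> \<AA> \<and> finite \<BB> \<and> algebra X \<BB> \<longrightarrow>
           (\<lambda>n. INF \<mu>\<in>fa_ball X \<AA>. dist_on \<BB> \<mu> (\<phi> n)) \<longlonglongrightarrow> 0) \<longrightarrow>
        (\<exists>\<nu> :: nat \<Rightarrow> 'a set \<Rightarrow> real.
           (\<forall>n. \<nu> n \<in> fa_measures X \<AA>) \<and>
           (\<exists>C::real. \<forall>n. variation \<AA> (\<nu> n) X \<le> ennreal C) \<and>
           (\<forall>a\<in>\<AA>. (\<lambda>n. \<phi> n a - \<nu> n a) \<longlonglongrightarrow> 0)))"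

definition Clop :: "'k::topological_space set set" where
  "Clop = {A. open A \<and> closed A}"

section \<open>Signed Radon measures\<close>

text \<open>Signed measures are set functions on the Borel sets, normalised to \<open>undefined\<close> elsewhere, so
  that equal measures are equal functions. Regularity is that of the variation.\<close>

definition radon_measures :: "('k::topological_space set \<Rightarrow> real) set" where
  "radon_measures = {\<nu>. \<nu> \<in> extensional (sets borel) \<and>
     (\<forall>A. range A \<subseteq> sets borel \<and> disjoint_family A \<longrightarrow> (\<lambda>i::nat. \<nu> (A i)) sums \<nu> (\<Union>i. A i)) \<and>
     variation (sets borel) \<nu> UNIV < \<infinity> \<and>
     (\<forall>B\<in>sets borel. variation (sets borel) \<nu> B =
        (SUP C\<in>{C. compact C \<and> C \<subseteq> B}. variation (sets borel) \<nu> C))}"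

definition radon_ball :: "('k::topological_space set \<Rightarrow> real) set" where
  "radon_ball = {\<nu> \<in> radon_measures. variation (sets borel) \<nu> UNIV \<le> 1}"

text \<open>The positive part \<open>\<nu>\<^sup>+(A) = sup {\<nu>(B) | B \<subseteq> A}\<close> of the Jordan decomposition; the negative part
  of \<open>\<nu>\<close> is the positive part of \<open>-\<nu>\<close>. Note that \<open>ennreal\<close> truncates negative values to \<open>0\<close>, which
  is the value at \<open>B = {}\<close>. The operator \<open>measure_of\<close> would return the null measure for a set function that
  is not a measure; \<open>emeasure_pos_part\<close> below shows that this does not happen.\<close>

definition pos_part :: "('k::topological_space set \<Rightarrow> real) \<Rightarrow> 'k measure" where
  "pos_part \<nu> = measure_of UNIV (sets borel)
     (\<lambda>A. SUP B\<in>{B \<in> sets borel. B \<subseteq> A}. ennreal (\<nu> B))"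

definition signed_integral :: "('k::topological_space set \<Rightarrow> real) \<Rightarrow> ('k \<Rightarrow> real) \<Rightarrow> real" where
  "signed_integral \<nu> g =
     integral\<^sup>L (pos_part \<nu>) g - integral\<^sup>L (pos_part (\<lambda>A. - \<nu> A)) g"

lemma emeasure_pos_part:
  fixes \<nu> :: "'k::topological_space set \<Rightarrow> real"
  assumes ca: "\<And>A. range A \<subseteq> sets borel \<Longrightarrow> disjoint_family A \<Longrightarrow>
                 (\<lambda>i::nat. \<nu> (A i)) sums \<nu> (\<Union>i. A i)"
    and A: "A \<in> sets borel"
  shows "emeasure (pos_part \<nu>) A = (SUP B\<in>{B \<in> sets borel. B \<subseteq> A}. ennreal (\<nu> B))"
proof -
  let ?u = "\<lambda>A. SUP B\<in>{B \<in> sets borel. B \<subseteq> A}. ennreal (\<nu> B)"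
  have "(\<lambda>i::nat. \<nu> {}) sums \<nu> {}"
    using ca[of "\<lambda>_. {}"] by (simp add: disjoint_family_on_def)
  then have "(\<lambda>i::nat. \<nu> {}) \<longlonglongrightarrow> 0"
    by (intro summable_LIMSEQ_zero) (simp add: sums_iff)
  then have e: "\<nu> {} = 0"
    by (simp add: LIMSEQ_const_iff)
  have add: "\<nu> (B \<union> C) = \<nu> B + \<nu> C"
    if "B \<in> sets borel" "C \<in> sets borel" "B \<inter> C = {}" for B C
  proof -
    have "(\<lambda>i. \<nu> (binaryset B C i)) sums \<nu> (\<Union>i. binaryset B C i)"
      using that by (intro ca) (auto simp: binaryset_def disjoint_family_on_def)
    moreover have "(\<lambda>i. \<nu> (binaryset B C i)) sums (\<nu> B + \<nu> C)"
      using binaryset_sums[of \<nu> B C] e by simp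
    ultimately show ?thesis
      by (simp add: UN_binaryset_eq sums_unique2)
  qed
  have super: "?u B + ?u C \<le> ?u (B \<union> C)" if bc: "B \<inter> C = {}" for B C
  proof -
    have ne: "{D \<in> sets borel. D \<subseteq> X} \<noteq> {}" for X :: "'k set" by auto
    have *: "ennreal (\<nu> D) + ennreal (\<nu> D') \<le> ?u (B \<union> C)"
      if D: "D \<in> sets borel" "D \<subseteq> B" "D' \<in> sets borel" "D' \<subseteq> C" for D D'
    proof -
      have up: "ennreal (\<nu> E) \<le> ?u (B \<union> C)" if "E \<in> sets borel" "E \<subseteq> B \<union> C" for E
        using that by (intro SUP_upper) auto
      have "\<nu> (D \<union> D') = \<nu> D + \<nu> D'"
        using D bc by (intro add) auto
      then have sum: "ennreal (\<nu> D + \<nu> D') \<le> ?u (B \<union> C)"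
        using up[of "D \<union> D'"] D by auto
      consider "\<nu> D \<ge> 0" "\<nu> D' \<ge> 0" | "\<nu> D < 0" | "\<nu> D' < 0" by linarith
      then show ?thesis
      proof cases
        case 1
        then show ?thesis using sum by (simp add: ennreal_plus)
      next
        case 2
        then show ?thesis using up[of D'] D by (auto simp: ennreal_neg)
      next
        case 3
        then show ?thesis using up[of D] D by (auto simp: ennreal_neg)
      qed
    qed
    have "?u B + ?u C = (SUP D\<in>{D \<in> sets borel. D \<subseteq> B}. ennreal (\<nu> D) + ?u C)"
      by (rule ennreal_SUP_add_left[symmetric]) (rule ne)
    also have "\<dots> = (SUP D\<in>{D \<in> sets borel. D \<subseteq> B}.
                     SUP D'\<in>{D \<in> sets borel. D \<subseteq> C}. ennreal (\<nu> D) + ennreal (\<nu> D'))"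
      by (subst ennreal_SUP_add_right[OF ne]) (rule refl)
    also have "\<dots> \<le> ?u (B \<union> C)"
      by (intro SUP_least *) auto
    finally show ?thesis .
  qed
  have "countably_additive (sets borel) ?u"
  proof (rule countably_additiveI)
    fix F :: "nat \<Rightarrow> 'k set"
    assume F: "range F \<subseteq> sets borel" and disj: "disjoint_family F"
    show "(\<Sum>i. ?u (F i)) = ?u (\<Union>i. F i)"
    proof (rule antisym)
      have fin: "(\<Sum>i<n. ?u (F i)) \<le> ?u (\<Union>i<n. F i)" for n
      proof (induction n)
        case (Suc n)
        have "F i \<inter> F n = {}" if "i < n" for i
          using disjoint_family_onD[OF disj, of i n] that by simp
        then have "(\<Union>i<n. F i) \<inter> F n = {}"
          by blast
        then have le: "?u (\<Union>i<n. F i) + ?u (F n) \<le> ?u ((\<Union>i<n. F i) \<union> F n)"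
          by (rule super)
        have eq: "(\<Union>i<n. F i) \<union> F n = (\<Union>i<Suc n. F i)"
          by (auto simp: less_Suc_eq)
        show ?case
          unfolding sum.lessThan_Suc using le unfolding eq
          by (rule order_trans[OF add_right_mono[OF Suc]])
      qed simp
      have mono: "?u (\<Union>i<n. F i) \<le> ?u (\<Union>i. F i)" for n
        by (rule SUP_subset_mono) auto
      have "(\<Sum>i<n. ?u (F i)) \<le> ?u (\<Union>i. F i)" for n
        using fin mono by (rule order_trans)
      then show "(\<Sum>i. ?u (F i)) \<le> ?u (\<Union>i. F i)"
        unfolding suminf_eq_SUP by (rule SUP_least)
      show "?u (\<Union>i. F i) \<le> (\<Sum>i. ?u (F i))"
      proof (rule SUP_least)
        fix B assume "B \<in> {B \<in> sets borel. B \<subseteq> (\<Union>i. F i)}"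
        then have B: "B \<in> sets borel" and eq: "(\<Union>i. B \<inter> F i) = B" by blast+
        have s: "(\<lambda>i. \<nu> (B \<inter> F i)) sums \<nu> B"
        proof -
          have "range (\<lambda>i. B \<inter> F i) \<subseteq> sets borel"
            using B F by auto
          moreover have "disjoint_family (\<lambda>i. B \<inter> F i)"
            using disjoint_family_onD[OF disj] by (auto simp: disjoint_family_on_def)
          ultimately show ?thesis
            using ca[of "\<lambda>i. B \<inter> F i"] unfolding eq by blast
        qed
        have le: "ennreal (\<nu> (B \<inter> F i)) \<le> ?u (F i)" for i
          using B F by (intro SUP_upper) (auto simp: image_subset_iff)
        have "ennreal (\<Sum>i<n. \<nu> (B \<inter> F i)) \<le> (\<Sum>i. ?u (F i))" for n
        proof -
          have "ennreal (\<Sum>i<n. \<nu> (B \<inter> F i)) \<le> ennreal (\<Sum>i<n. max 0 (\<nu> (B \<inter> F i)))"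
            by (intro ennreal_leI sum_mono) auto
          also have "\<dots> = (\<Sum>i<n. ennreal (max 0 (\<nu> (B \<inter> F i))))"
            by (intro sum_ennreal[symmetric]) auto
          also have "\<dots> = (\<Sum>i<n. ennreal (\<nu> (B \<inter> F i)))"
            by (intro sum.cong) (auto simp: max_def ennreal_neg)
          also have "\<dots> \<le> (\<Sum>i<n. ?u (F i))"
            by (intro sum_mono le)
          also have "\<dots> \<le> (\<Sum>i. ?u (F i))"
            by (intro sum_le_suminf) auto
          finally show ?thesis .
        qed
        moreover have "(\<lambda>n. ennreal (\<Sum>i<n. \<nu> (B \<inter> F i))) \<longlonglongrightarrow> ennreal (\<nu> B)"
          using s unfolding sums_def by (rule tendsto_ennrealI)
        ultimately show "ennreal (\<nu> B) \<le> (\<Sum>i. ?u (F i))"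
          by (intro LIMSEQ_le_const2) auto
      qed
    qed
  qed
  moreover have "positive (sets borel) ?u"
    using e by (simp add: positive_def conj_commute cong: conj_cong)
  moreover have "sigma_algebra UNIV (sets (borel :: 'k measure))"
    using sets.sigma_algebra_axioms[of "borel :: 'k measure"] by simp
  ultimately show ?thesis
    using emeasure_measure_of_sigma[OF _ _ _ A] unfolding pos_part_def by blast
qed

text \<open>The unit ball with the weak* topology, that is, the coarsest topology making
  \<open>\<nu> \<mapsto> \<integral> g d\<nu>\<close> continuous for each \<open>g\<close> in \<open>C(K)\<close>. Here and below \<open>C(K)\<close> is the type
  \<open>'k \<Rightarrow>\<^sub>C real\<close> of bounded continuous functions with the supremum norm.\<close>

definition weak_star_ball :: "('k::topological_space set \<Rightarrow> real) topology" where
  "weak_star_ball = pullback_topology radon_ball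
     (\<lambda>\<nu> (g :: 'k \<Rightarrow>\<^sub>C real). signed_integral \<nu> (apply_bcontfun g)) (powertop_real UNIV)"

section \<open>The *extension property\<close>

text \<open>The space \<open>L'\<close> is the universe of a Hausdorff type \<open>'c\<close>, and \<open>L\<close> is regarded as a subspace of
  it by means of an embedding \<open>e\<close>.\<close>

definition countable_discrete_extension :: "'l topology \<Rightarrow> ('l \<Rightarrow> 'c::t2_space) \<Rightarrow> bool" where
  "countable_discrete_extension L e \<longleftrightarrow>
     compact_space L \<and> compact (UNIV :: 'c set) \<and> embedding_map L euclidean e \<and>
     countable (UNIV - e ` topspace L) \<and> discrete (UNIV - e ` topspace L)"

text \<open>The second type argument is the type carrying \<open>L'\<close>. A quantifier cannot range over types, so
  a space has the *extension property if this holds for every \<open>'c\<close>.\<close>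

definition star_extension_property :: "'k::t2_space itself \<Rightarrow> 'c::t2_space itself \<Rightarrow> bool" where
  "star_extension_property _ _ \<longleftrightarrow>
     (\<forall>e :: ('k set \<Rightarrow> real) \<Rightarrow> 'c. countable_discrete_extension weak_star_ball e \<longrightarrow>
        (\<exists>E :: ('k \<Rightarrow>\<^sub>C real) \<Rightarrow>\<^sub>L ('c \<Rightarrow>\<^sub>C real). \<forall>g. \<forall>\<nu>\<in>radon_ball.
           apply_bcontfun (blinfun_apply E g) (e \<nu>) = signed_integral \<nu> (apply_bcontfun g)))"

end

theory Submission
  imports Defs
begin

text \<open>Let \<open>L'\<close> be a countable discrete extension of the ball \<open>L = M\<^sub>1(K)\<close>. Prescribing \<open>Eg\<close> on \<open>L\<close> to be
  \<open>\<nu> \<mapsto> \<nu>(g)\<close> leaves one bounded functional on \<open>C(K)\<close> to be chosen at each of the countably many points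
  \<open>x\<^sub>n\<close> of \<open>L' - L\<close>, so that the values fit together continuously; the approximation property provides
  them. For each clopen \<open>a\<close> the weak* continuous function \<open>\<nu> \<mapsto> \<nu>(a)\<close> extends, by Tietze, to a
  continuous \<open>f\<^sub>a : L' \<rightarrow> [-1,1]\<close> (\<open>clopen_values_extend\<close>). The numbers \<open>\<phi>\<^sub>n(a) = f\<^sub>a(x\<^sub>n)\<close> need not
  depend additively on \<open>a\<close>. But for a finite algebra \<open>\<BB>\<close> the points at which \<open>(f\<^sub>b)\<close>, \<open>b \<in> \<BB>\<close>, is at
  distance at least \<open>\<epsilon>\<close> from every member of the ball form a closed set disjoint from \<open>L\<close>, hence a
  compact discrete and therefore finite set (\<open>extended_values_near_ball\<close>). So the approximation
  property applies and yields uniformly bounded finitely additive \<open>\<mu>\<^sub>n\<close> with \<open>\<phi>\<^sub>n(a) - \<mu>\<^sub>n(a) \<rightarrow> 0\<close>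
  for all \<open>a\<close>.

  Put \<open>Eg(x\<^sub>n) = \<integral> g d\<mu>\<^sub>n\<close>. For \<open>g = 1\<^sub>a\<close> the difference of \<open>Eg\<close> and the continuous \<open>f\<^sub>a\<close> vanishes on \<open>L\<close> and
  tends to \<open>0\<close> along the isolated points \<open>x\<^sub>n\<close>, so it is continuous
  (\<open>continuous_if_vanishing_along_isolated_points\<close>). Since \<open>K\<close> is zerodimensional, the
  functions \<open>1\<^sub>a\<close> span a dense subspace of \<open>C(K)\<close>
  (\<open>closed_subspace_containing_clopen_indicators\<close>), and since the functionals \<open>g \<mapsto> Eg(x)\<close> are
  uniformly bounded, continuity of \<open>Eg\<close> passes from these to all \<open>g\<close>
  (\<open>bounded_operator_from_clopen_indicators\<close>).

  The integral against a finitely additive \<open>\<mu>\<close> is obtained in \<open>fa_integral_exists\<close> as a limit of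
  Riemann sums over ever finer finite clopen partitions; its convergence rests on the same density
  statement.\<close>

section \<open>Finitely additive functions of bounded variation\<close>

lemma additive_on_disjoint_Union:
  fixes \<mu> :: "'a set \<Rightarrow> real"
  assumes "algebra \<Omega> M" "Measure_Space.additive M \<mu>"
    and "finite P" "P \<subseteq> M" "disjoint P"
  shows "\<mu> (\<Union>P) = (\<Sum>B\<in>P. \<mu> B)"
  using assms(3-5)
proof (induction P)
  case empty
  interpret algebra \<Omega> M by fact
  show ?case
    using assms(2) unfolding Measure_Space.additive_def by fastforce
next
  case (insert B P)
  interpret algebra \<Omega> M by fact
  have "B \<inter> \<Union>P = {}"
    using insert.prems insert.hyps by (auto simp: pairwise_def disjnt_def)
  moreover have "\<Union>P \<in> M"
    using insert.prems insert.hyps by auto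
  ultimately have "\<mu> (B \<union> \<Union>P) = \<mu> B + \<mu> (\<Union>P)"
    using assms(2) insert.prems unfolding Measure_Space.additive_def by simp
  then show ?case
    using insert by (simp add: pairwise_insert)
qed

lemma sum_abs_le_variation:
  assumes "variation M \<mu> A \<le> ennreal C" "0 \<le> C"
    and "finite P" "P \<subseteq> M" "partition_on A P"
  shows "(\<Sum>B\<in>P. \<bar>\<mu> B\<bar>) \<le> C"
proof -
  have "(\<Sum>B\<in>P. ennreal \<bar>\<mu> B\<bar>) \<le> variation M \<mu> A"
    unfolding variation_def using assms by (intro SUP_upper) auto
  then have "ennreal (\<Sum>B\<in>P. \<bar>\<mu> B\<bar>) \<le> ennreal C"
    using assms(1) by (simp add: sum_ennreal)
  then show ?thesis
    using assms(2) by simp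
qed

lemma abs_le_variation:
  assumes "algebra \<Omega> M" "Measure_Space.additive M \<mu>"
    and "variation M \<mu> \<Omega> \<le> ennreal C" "0 \<le> C" "A \<in> M"
  shows "\<bar>\<mu> A\<bar> \<le> C"
proof (cases "A = {}")
  case True
  then show ?thesis
    using additive_on_disjoint_Union[OF assms(1,2), of "{}"] assms by simp
next
  case False
  interpret algebra \<Omega> M by fact
  let ?P = "{A, \<Omega> - A} - {{}}"
  have "A \<subseteq> \<Omega>"
    using assms sets_into_space by auto
  then have "partition_on \<Omega> ?P"
    by (auto simp: partition_on_def pairwise_def disjnt_def)
  then have "(\<Sum>B\<in>?P. \<bar>\<mu> B\<bar>) \<le> C"
    using assms by (intro sum_abs_le_variation) auto
  moreover have "\<bar>\<mu> A\<bar> \<le> (\<Sum>B\<in>?P. \<bar>\<mu> B\<bar>)"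
    using False by (intro member_le_sum) auto
  ultimately show ?thesis
    by simp
qed

lemma algebra_Clop: "algebra UNIV (Clop :: 'k::topological_space set set)"
  unfolding algebra_iff_Un by (auto simp: Clop_def)

section \<open>Density of the clopen simple functions\<close>

definition clopen_indicator :: "'k::topological_space set \<Rightarrow> 'k \<Rightarrow>\<^sub>C real" where
  "clopen_indicator a = Bcontfun (indicator a)"

lemma clopen_indicator_apply:
  assumes "a \<in> Clop"
  shows "apply_bcontfun (clopen_indicator a) = indicator a"
proof -
  have "continuous_on UNIV (indicator a :: 'a \<Rightarrow> real)"
  proof (subst continuous_on_open_vimage[OF open_UNIV], intro allI impI)
    fix U :: "real set"
    have "indicator a -` U \<inter> UNIV = (if 1 \<in> U then a else {}) \<union> (if 0 \<in> U then - a else {})"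
      by (auto simp: indicator_def of_bool_def split: if_splits)
    then show "open (indicator a -` U \<inter> UNIV)"
      using assms by (auto simp: Clop_def)
  qed
  then have "(indicator a :: 'a \<Rightarrow> real) \<in> bcontfun"
    by (rule bcontfun_normI[where b=1]) (auto simp: indicator_def)
  then show ?thesis
    unfolding clopen_indicator_def by (simp add: Bcontfun_inverse)
qed

text \<open>Finite sets of clopen sets, directed by inclusion, stand for finite clopen partitions of the space:
  the partition belonging to \<open>S\<close> consists of the atoms of the algebra generated by \<open>S\<close>, and it gets
  finer as \<open>S\<close> grows.\<close>

definition atom :: "'a set set \<Rightarrow> 'a \<Rightarrow> 'a set" where
  "atom S x = {y. \<forall>s\<in>S. y \<in> s \<longleftrightarrow> x \<in> s}"

lemma self_in_atom [simp]: "x \<in> atom S x"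
  by (simp add: atom_def)

lemma some_in_atom [simp]: "(SOME y. y \<in> atom S x) \<in> atom S x"
  by (rule someI[of "\<lambda>y. y \<in> atom S x"]) (rule self_in_atom)

lemma atom_eq_iff: "atom S x = atom S y \<longleftrightarrow> y \<in> atom S x"
  unfolding atom_def by blast

lemma atom_subset_iff:
  assumes "a \<in> S" "y \<in> atom S x"
  shows "atom S x \<subseteq> a \<longleftrightarrow> y \<in> a"
  using assms unfolding atom_def by blast

lemma partition_on_atoms: "partition_on UNIV (range (atom S))"
proof (rule partition_onI)
  show "disjnt p q" if pq: "p \<in> range (atom S)" "q \<in> range (atom S)" "p \<noteq> q" for p q
  proof -
    obtain x y where xy: "p = atom S x" "q = atom S y"
      using pq(1,2) by blast
    have False if "z \<in> atom S x" "z \<in> atom S y" for z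
      using that pq(3) unfolding xy atom_eq_iff[symmetric] by simp
    then show ?thesis
      unfolding xy disjnt_def by blast
  qed
  show "\<Union>(range (atom S)) = UNIV"
    using self_in_atom[of _ S] by auto
  have "atom S x \<noteq> {}" for x
    by (metis empty_iff self_in_atom)
  then show "{} \<notin> range (atom S)"
    by auto
qed

lemma finite_atoms:
  assumes "finite S"
  shows "finite (range (atom S))"
proof -
  have "atom S x = {y. {s\<in>S. y \<in> s} = {s\<in>S. x \<in> s}}" for x
    by (auto simp: atom_def)
  then have "range (atom S) \<subseteq> (\<lambda>T. {y. {s\<in>S. y \<in> s} = T}) ` Pow S"
    by auto
  moreover have "finite (Pow S)"
    using assms by simp
  ultimately show ?thesis
    by (rule finite_surj[rotated])
qed

lemma atom_clopen:
  assumes "finite S" "S \<subseteq> Clop"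
  shows "atom S x \<in> Clop"
proof -
  have "atom S x = (\<Inter>s\<in>S. if x \<in> s then s else - s)"
    by (auto simp: atom_def split: if_splits)
  then show ?thesis
    using assms by (auto simp: Clop_def subset_iff simp del: if_image_distrib
        intro!: open_INT closed_INT open_Compl closed_Compl)
qed

text \<open>Compactness gives a finite cover by clopen sets on each of which \<open>g\<close> varies little. Two points in
  the same atom of the cover lie in a common member, so \<open>g\<close> varies little on atoms too.\<close>

lemma finite_clopen_small_oscillation:
  fixes g :: "'k::t2_space \<Rightarrow>\<^sub>C real"
  assumes "compact (UNIV :: 'k set)" "topological_basis (Clop :: 'k set set)" "0 < \<epsilon>"
  obtains S where "finite S" "S \<subseteq> Clop"
    "\<And>x y. y \<in> atom S x \<Longrightarrow> \<bar>apply_bcontfun g x - apply_bcontfun g y\<bar> < \<epsilon>"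
proof -
  have "\<exists>s\<in>Clop. x \<in> s \<and> s \<subseteq> apply_bcontfun g -` ball (apply_bcontfun g x) (\<epsilon>/2)" for x
  proof -
    have "open (apply_bcontfun g -` ball (apply_bcontfun g x) (\<epsilon>/2))"
      by (intro open_vimage) auto
    then show ?thesis
      using assms by (elim topological_basisE) auto
  qed
  then obtain s where s: "\<And>x. s x \<in> Clop" "\<And>x. x \<in> s x"
    "\<And>x. s x \<subseteq> apply_bcontfun g -` ball (apply_bcontfun g x) (\<epsilon>/2)"
    by metis
  obtain X where X: "finite X" "UNIV \<subseteq> (\<Union>x\<in>X. s x)"
  proof (rule compactE_image[OF assms(1), of UNIV s])
    show "open (s x)" for x
      using s(1) by (simp add: Clop_def)
  qed (use s(2) in auto)
  show ?thesis
  proof (rule that[of "s ` X"])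
    fix x y assume y: "y \<in> atom (s ` X) x"
    obtain z where z: "z \<in> X" "x \<in> s z"
      using X by auto
    then have "y \<in> s z"
      using y by (auto simp: atom_def)
    then have "dist (apply_bcontfun g z) (apply_bcontfun g y) < \<epsilon>/2"
      and "dist (apply_bcontfun g z) (apply_bcontfun g x) < \<epsilon>/2"
      using s(3)[of z] z by auto
    then show "\<bar>apply_bcontfun g x - apply_bcontfun g y\<bar> < \<epsilon>"
      unfolding dist_real_def by linarith
  qed (use X s in auto)
qed

lemma sum_bcontfun_apply:
  "apply_bcontfun (sum f A) x = (\<Sum>i\<in>A. apply_bcontfun (f i :: 'k::topological_space \<Rightarrow>\<^sub>C real) x)"
  by (induction A rule: infinite_finite_induct) auto

text \<open>A function is uniformly close to the step function that takes, on each atom, its value at a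
  sample point. The statement is in the form of an induction rule: a property that defines a closed
  subspace of \<open>C(K)\<close> need only be checked for the indicators of clopen sets.\<close>

lemma closed_subspace_containing_clopen_indicators:
  fixes V :: "('k::t2_space \<Rightarrow>\<^sub>C real) set"
  assumes K: "compact (UNIV :: 'k set)" "topological_basis (Clop :: 'k set set)"
    and V: "closed V" "subspace V" "\<And>a. a \<in> Clop \<Longrightarrow> clopen_indicator a \<in> V"
  shows "g \<in> V"
proof -
  have "\<exists>h\<in>V. dist h g < \<epsilon>" if "0 < \<epsilon>" for \<epsilon>
  proof -
    obtain S where S: "finite S" "S \<subseteq> Clop"
      and osc: "\<And>x y. y \<in> atom S x \<Longrightarrow> \<bar>apply_bcontfun g x - apply_bcontfun g y\<bar> < \<epsilon>/2"
      using finite_clopen_small_oscillation[OF K, of "\<epsilon>/2" g] \<open>0 < \<epsilon>\<close> by auto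
    define h where
      "h = (\<Sum>B\<in>range (atom S). apply_bcontfun g (SOME x. x \<in> B) *\<^sub>R clopen_indicator B)"
    have "h \<in> V"
      unfolding h_def using V S
      by (auto intro!: subspace_sum subspace_scale atom_clopen)
    have "dist (apply_bcontfun h x) (apply_bcontfun g x) \<le> \<epsilon>/2" for x
    proof -
      have "apply_bcontfun h x =
        (\<Sum>B\<in>range (atom S). if B = atom S x then apply_bcontfun g (SOME x. x \<in> B) else 0)"
        unfolding h_def sum_bcontfun_apply
        using S by (intro sum.cong refl)
          (auto simp: clopen_indicator_apply atom_clopen indicator_def atom_eq_iff[symmetric])
      also have "\<dots> = apply_bcontfun g (SOME y. y \<in> atom S x)"
        using finite_atoms[OF S(1)] by (simp add: sum.delta')
      finally have "apply_bcontfun h x = apply_bcontfun g (SOME y. y \<in> atom S x)" .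
      moreover have "(SOME y. y \<in> atom S x) \<in> atom S x"
        by (rule some_in_atom)
      ultimately show ?thesis
        using osc[of "SOME y. y \<in> atom S x" x] by (simp add: dist_real_def abs_minus_commute)
    qed
    then have "dist h g \<le> \<epsilon>/2"
      by (rule dist_bound)
    then show ?thesis
      using \<open>h \<in> V\<close> \<open>0 < \<epsilon>\<close> by (intro bexI[of _ h]) auto
  qed
  then have "g \<in> closure V"
    by (simp add: closure_approachable)
  then show ?thesis
    using \<open>closed V\<close> by simp
qed

section \<open>Integration against a finitely additive function\<close>

definition riemann_sum :: "('k::topological_space set \<Rightarrow> real) \<Rightarrow> 'k set set \<Rightarrow> ('k \<Rightarrow>\<^sub>C real) \<Rightarrow> real" where
  "riemann_sum \<mu> S g = (\<Sum>B\<in>range (atom S). apply_bcontfun g (SOME x. x \<in> B) * \<mu> B)"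

lemma riemann_sum_zero: "riemann_sum \<mu> S 0 = 0"
  by (simp add: riemann_sum_def)

lemma riemann_sum_add: "riemann_sum \<mu> S (g + h) = riemann_sum \<mu> S g + riemann_sum \<mu> S h"
  by (simp add: riemann_sum_def distrib_right sum.distrib)

lemma riemann_sum_scale: "riemann_sum \<mu> S (c *\<^sub>R g) = c * riemann_sum \<mu> S g"
  by (simp add: riemann_sum_def mult.assoc sum_distrib_left)

lemma riemann_sum_diff: "riemann_sum \<mu> S (g - h) = riemann_sum \<mu> S g - riemann_sum \<mu> S h"
  by (simp add: riemann_sum_def left_diff_distrib sum_subtractf)

text \<open>The bound does not depend on \<open>S\<close>; it makes the Riemann sums equicontinuous in \<open>g\<close>, which is what
  carries convergence from a dense subspace to all of \<open>C(K)\<close>.\<close>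

lemma riemann_sum_bound:
  assumes "variation Clop \<mu> UNIV \<le> ennreal C" "0 \<le> C" "finite S" "S \<subseteq> Clop"
  shows "\<bar>riemann_sum \<mu> S g\<bar> \<le> C * norm g"
proof -
  have "\<bar>riemann_sum \<mu> S g\<bar> \<le> (\<Sum>B\<in>range (atom S). norm g * \<bar>\<mu> B\<bar>)"
    unfolding riemann_sum_def
    by (rule sum_abs[THEN order_trans], rule sum_mono)
       (use norm_bounded[of g] in \<open>auto simp: abs_mult intro!: mult_right_mono\<close>)
  also have "\<dots> = (\<Sum>B\<in>range (atom S). \<bar>\<mu> B\<bar>) * norm g"
    by (simp add: sum_distrib_left mult.commute)
  also have "\<dots> \<le> C * norm g"
    using assms sum_abs_le_variation[OF assms(1,2) finite_atoms[OF assms(3)] _ partition_on_atoms]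
    by (intro mult_right_mono) (auto intro!: atom_clopen)
  finally show ?thesis .
qed

text \<open>Once \<open>a\<close> is in \<open>S\<close> it is a union of atoms, so the sum is stationary in \<open>S\<close> from \<open>{a}\<close> onwards.\<close>

lemma riemann_sum_clopen_indicator:
  assumes "Measure_Space.additive Clop \<mu>" "finite S" "S \<subseteq> Clop" "a \<in> S"
  shows "riemann_sum \<mu> S (clopen_indicator a) = \<mu> a"
proof -
  let ?P = "{B \<in> range (atom S). B \<subseteq> a}"
  have disj: "disjoint ?P"
    using partition_onD2[OF partition_on_atoms[of S]] by (rule pairwise_subset) blast
  have "riemann_sum \<mu> S (clopen_indicator a) = (\<Sum>B\<in>range (atom S). if B \<subseteq> a then \<mu> B else 0)"
    unfolding riemann_sum_def
  proof (rule sum.cong[OF refl])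
    fix B assume "B \<in> range (atom S)"
    then obtain x where x: "B = atom S x"
      by blast
    have "(SOME y. y \<in> B) \<in> a \<longleftrightarrow> B \<subseteq> a"
      unfolding x using atom_subset_iff[OF \<open>a \<in> S\<close> some_in_atom] by blast
    moreover have "a \<in> Clop"
      using assms by blast
    ultimately show "apply_bcontfun (clopen_indicator a) (SOME y. y \<in> B) * \<mu> B =
        (if B \<subseteq> a then \<mu> B else 0)"
      by (cases "B \<subseteq> a") (simp_all add: clopen_indicator_apply)
  qed
  also have "\<dots> = (\<Sum>B\<in>?P. \<mu> B)"
    using finite_atoms[OF assms(2)] by (rule sum.inter_filter[symmetric])
  also have "\<dots> = \<mu> (\<Union>?P)"
  proof (rule additive_on_disjoint_Union[OF algebra_Clop assms(1) _ _ disj, symmetric])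
    show "finite ?P"
      by (rule finite_subset[OF _ finite_atoms[OF assms(2)]]) blast
    show "?P \<subseteq> Clop"
      using atom_clopen[OF assms(2,3)] by blast
  qed
  also have "\<Union>?P = a"
  proof (intro equalityI subsetI)
    fix x assume "x \<in> a"
    then have "atom S x \<subseteq> a"
      using atom_subset_iff[OF \<open>a \<in> S\<close> self_in_atom] by blast
    then show "x \<in> \<Union>?P"
      using self_in_atom[of x S] by blast
  qed blast
  finally show ?thesis .
qed

text \<open>The functions whose Riemann sums converge form a subspace that contains the clopen indicators,
  and equicontinuity of the sums makes it closed, so it is all of \<open>C(K)\<close>. Linearity, the norm bound and
  the values at indicators are inherited by the limit.\<close>

lemma fa_integral_exists:
  fixes \<mu> :: "'k::t2_space set \<Rightarrow> real"
  assumes K: "compact (UNIV :: 'k set)" "topological_basis (Clop :: 'k set set)"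
    and \<mu>: "Measure_Space.additive Clop \<mu>" "variation Clop \<mu> UNIV \<le> ennreal C" "0 \<le> C"
  shows "\<exists>\<Lambda> :: ('k \<Rightarrow>\<^sub>C real) \<Rightarrow> real. linear \<Lambda> \<and> (\<forall>g. \<bar>\<Lambda> g\<bar> \<le> C * norm g) \<and>
           (\<forall>a\<in>Clop. \<Lambda> (clopen_indicator a) = \<mu> a)"
proof -
  let ?F = "finite_subsets_at_top (Clop :: 'k set set)"
  define V where "V = {g. \<exists>l. ((\<lambda>S. riemann_sum \<mu> S g) \<longlongrightarrow> l) ?F}"
  have ind: "((\<lambda>S. riemann_sum \<mu> S (clopen_indicator a)) \<longlongrightarrow> \<mu> a) ?F" if "a \<in> Clop" for a
  proof -
    have "\<forall>\<^sub>F S in ?F. riemann_sum \<mu> S (clopen_indicator a) = \<mu> a"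
      unfolding eventually_finite_subsets_at_top
      using that riemann_sum_clopen_indicator[OF \<mu>(1)] by (intro exI[of _ "{a}"]) auto
    then show ?thesis
      by (rule tendsto_eventually)
  qed
  have add: "((\<lambda>S. riemann_sum \<mu> S (g + h)) \<longlongrightarrow> l + m) ?F"
    if "((\<lambda>S. riemann_sum \<mu> S g) \<longlongrightarrow> l) ?F" "((\<lambda>S. riemann_sum \<mu> S h) \<longlongrightarrow> m) ?F" for g h l m
    unfolding riemann_sum_add using that by (rule tendsto_add)
  have scale: "((\<lambda>S. riemann_sum \<mu> S (c *\<^sub>R g)) \<longlongrightarrow> c * l) ?F"
    if "((\<lambda>S. riemann_sum \<mu> S g) \<longlongrightarrow> l) ?F" for c g l
    unfolding riemann_sum_scale using that by (rule tendsto_mult_left)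
  have "g \<in> V" for g
  proof (rule closed_subspace_containing_clopen_indicators[OF K])
    show "subspace V"
      unfolding subspace_def V_def using add scale
      by (auto simp: riemann_sum_zero) blast+
    show "clopen_indicator a \<in> V" if "a \<in> Clop" for a
      using ind[OF that] by (auto simp: V_def)
    have "g \<in> V" if g: "g \<in> closure V" for g
    proof -
      have "cauchy_filter (filtermap (\<lambda>S. riemann_sum \<mu> S g) ?F)"
        unfolding cauchy_filter_metric_filtermap
      proof (intro allI impI)
        fix \<epsilon> :: real assume "0 < \<epsilon>"
        \<comment> \<open>chosen so that replacing \<open>g\<close> by a function at distance less than \<open>\<delta>\<close> changes every Riemann sum by less
            than \<open>\<epsilon>/4\<close>; the summand \<open>1\<close> covers \<open>C = 0\<close>\<close>
        define \<delta> where "\<delta> = \<epsilon> / (4 * (C + 1))"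
        have "0 < \<delta>"
          using \<open>0 < \<epsilon>\<close> \<open>0 \<le> C\<close> by (simp add: \<delta>_def)
        have C\<delta>: "C * \<delta> < \<epsilon>/4"
          using \<open>0 < \<epsilon>\<close> \<open>0 \<le> C\<close> by (simp add: \<delta>_def field_simps)
        obtain h where "h \<in> V" and hg: "dist h g < \<delta>"
          using g \<open>0 < \<delta>\<close> unfolding closure_approachable by blast
        then obtain l where l: "((\<lambda>S. riemann_sum \<mu> S h) \<longlongrightarrow> l) ?F"
          by (auto simp: V_def)
        have near: "\<forall>\<^sub>F S in ?F. dist (riemann_sum \<mu> S h) l < \<epsilon>/4"
          using tendstoD[OF l, of "\<epsilon>/4"] \<open>0 < \<epsilon>\<close> by simp
        have fin: "\<forall>\<^sub>F S in ?F. finite S \<and> S \<subseteq> Clop"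
          by (rule eventually_finite_subsets_at_top_weakI) simp
        have "\<forall>\<^sub>F S in ?F. dist (riemann_sum \<mu> S g) l < \<epsilon>/2"
          using near fin
        proof eventually_elim
          case (elim S)
          then have "\<bar>riemann_sum \<mu> S (g - h)\<bar> \<le> C * norm (g - h)"
            by (intro riemann_sum_bound[OF \<mu>(2,3)]) auto
          also have "\<dots> \<le> C * \<delta>"
            using hg \<open>0 \<le> C\<close> by (intro mult_left_mono) (auto simp: dist_norm norm_minus_commute)
          finally show ?case
            using elim(1) C\<delta> unfolding riemann_sum_diff dist_real_def by linarith
        qed
        moreover have "dist x y < \<epsilon>" if "dist x l < \<epsilon>/2" "dist y l < \<epsilon>/2" for x y
          using that by (rule dist_triangle_half_l)
        ultimately show "\<exists>P. eventually P ?F \<and>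
            (\<forall>S T. P S \<and> P T \<longrightarrow> dist (riemann_sum \<mu> S g) (riemann_sum \<mu> T g) < \<epsilon>)"
          by blast
      qed
      then have "\<exists>l\<in>UNIV. filtermap (\<lambda>S. riemann_sum \<mu> S g) ?F \<le> nhds l"
        using complete_UNIV[where 'a=real] unfolding complete_uniform
        by (auto simp: filtermap_bot_iff)
      then show ?thesis
        by (auto simp: V_def filterlim_def)
    qed
    then show "closed V"
      using closure_subset_eq by blast
  qed
  then have "\<forall>g. \<exists>l. ((\<lambda>S. riemann_sum \<mu> S g) \<longlongrightarrow> l) ?F"
    by (simp add: V_def)
  then obtain \<Lambda> where \<Lambda>: "\<And>g. ((\<lambda>S. riemann_sum \<mu> S g) \<longlongrightarrow> \<Lambda> g) ?F"
    by metis
  have uniq: "\<Lambda> g = l" if "((\<lambda>S. riemann_sum \<mu> S g) \<longlongrightarrow> l) ?F" for g l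
    using \<Lambda> that by (rule tendsto_unique[rotated]) simp
  have "linear \<Lambda>"
    by (rule linearI) (use uniq add scale \<Lambda> in auto)
  moreover have "\<bar>\<Lambda> g\<bar> \<le> C * norm g" for g
  proof (rule tendsto_upperbound[OF tendsto_rabs[OF \<Lambda>[of g]]])
    show "\<forall>\<^sub>F S in ?F. \<bar>riemann_sum \<mu> S g\<bar> \<le> C * norm g"
      by (intro eventually_finite_subsets_at_top_weakI riemann_sum_bound[OF \<mu>(2,3)])
  qed simp
  moreover have "\<Lambda> (clopen_indicator a) = \<mu> a" if "a \<in> Clop" for a
    using uniq ind that by blast
  ultimately show ?thesis
    by blast
qed

section \<open>Integration against a signed Radon measure\<close>

lemma radon_ball_countably_additive:
  assumes "\<nu> \<in> radon_ball" "range A \<subseteq> sets borel" "disjoint_family A"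
  shows "(\<lambda>i::nat. \<nu> (A i)) sums \<nu> (\<Union>i. A i)"
  using assms by (auto simp: radon_ball_def radon_measures_def)

lemma radon_ball_additive:
  fixes \<nu> :: "'k::topological_space set \<Rightarrow> real"
  assumes "\<nu> \<in> radon_ball"
  shows "Measure_Space.additive (sets borel) \<nu>"
  unfolding Measure_Space.additive_def
proof (intro ballI impI)
  fix B C :: "'k set" assume BC: "B \<in> sets borel" "C \<in> sets borel" "B \<inter> C = {}"
  have "(\<lambda>i::nat. \<nu> {}) sums \<nu> {}"
    using radon_ball_countably_additive[OF assms, of "\<lambda>_. {}"] by (simp add: disjoint_family_on_def)
  then have "\<nu> {} = 0"
    using summable_LIMSEQ_zero[of "\<lambda>i::nat. \<nu> {}"] by (simp add: sums_iff LIMSEQ_const_iff)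
  have "(\<lambda>i. \<nu> (binaryset B C i)) sums \<nu> (\<Union>i. binaryset B C i)"
    using BC by (intro radon_ball_countably_additive[OF assms])
      (auto simp: binaryset_def disjoint_family_on_def)
  moreover have "(\<lambda>i. \<nu> (binaryset B C i)) sums (\<nu> B + \<nu> C)"
    using binaryset_sums[of \<nu> B C] \<open>\<nu> {} = 0\<close> by simp
  ultimately show "\<nu> (B \<union> C) = \<nu> B + \<nu> C"
    by (simp add: UN_binaryset_eq sums_unique2)
qed

lemma radon_ball_abs_le_1:
  fixes \<nu> :: "'k::topological_space set \<Rightarrow> real"
  assumes "\<nu> \<in> radon_ball" "A \<in> sets borel"
  shows "\<bar>\<nu> A\<bar> \<le> 1"
proof (rule abs_le_variation[OF _ radon_ball_additive])
  show "algebra UNIV (sets (borel :: 'k measure))"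
    using sets.algebra_axioms[of "borel :: 'k measure"] by simp
  show "variation (sets borel) \<nu> UNIV \<le> ennreal 1"
    using assms by (simp add: radon_ball_def)
qed (use assms in auto)

lemma radon_ball_imp_fa_ball:
  fixes \<nu> :: "'k::topological_space set \<Rightarrow> real"
  assumes "\<nu> \<in> radon_ball"
  shows "\<nu> \<in> fa_ball UNIV Clop"
proof -
  have Clop: "(Clop :: 'k set set) \<subseteq> sets borel"
    by (auto simp: Clop_def)
  then have "Measure_Space.additive Clop \<nu>"
    using radon_ball_additive[OF assms] unfolding Measure_Space.additive_def by blast
  moreover have "variation Clop \<nu> UNIV \<le> variation (sets borel) \<nu> UNIV"
    unfolding variation_def using Clop by (intro SUP_subset_mono) auto
  then have "variation Clop \<nu> UNIV \<le> 1"
    using assms by (auto simp: radon_ball_def)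
  ultimately show ?thesis
    by (auto simp: fa_ball_def fa_measures_def le_less_trans[OF _ ennreal_one_less_top])
qed

lemma sets_pos_part [simp]: "sets (pos_part \<nu>) = sets borel"
  and space_pos_part [simp]: "space (pos_part \<nu>) = UNIV"
  using sets.sigma_sets_eq[of borel] by (auto simp: pos_part_def)

text \<open>The following is applied both to a member \<open>\<nu>\<close> of the ball and to \<open>-\<nu>\<close>. The latter need not be a
  member itself, being \<open>- undefined\<close> rather than \<open>undefined\<close> on non-Borel sets; so only countable
  additivity and a bound on the values are assumed.\<close>

context
  fixes \<nu> :: "'k::topological_space set \<Rightarrow> real"
  assumes ca: "\<And>A. range A \<subseteq> sets borel \<Longrightarrow> disjoint_family A \<Longrightarrow>
                 (\<lambda>i::nat. \<nu> (A i)) sums \<nu> (\<Union>i. A i)"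
    and bound: "\<And>A. A \<in> sets borel \<Longrightarrow> \<bar>\<nu> A\<bar> \<le> 1"
begin

lemma emeasure_pos_part_le:
  assumes "A \<in> sets borel" "\<And>B. B \<in> sets borel \<Longrightarrow> B \<subseteq> A \<Longrightarrow> \<nu> B \<le> c"
  shows "emeasure (pos_part \<nu>) A \<le> ennreal c"
  by (subst emeasure_pos_part[OF _ assms(1)])
     (use ca assms(2) in \<open>auto intro!: SUP_least ennreal_leI\<close>)

lemma finite_measure_pos_part: "finite_measure (pos_part \<nu>)"
proof (rule finite_measureI)
  have "emeasure (pos_part \<nu>) UNIV \<le> ennreal 1"
    using bound by (intro emeasure_pos_part_le) (auto simp: abs_le_iff)
  then show "emeasure (pos_part \<nu>) (space (pos_part \<nu>)) \<noteq> \<infinity>"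
    using ennreal_one_less_top by (auto simp: top_unique)
qed

interpretation finite_measure "pos_part \<nu>"
  by (rule finite_measure_pos_part)

lemma measure_pos_part_least:
  assumes "A \<in> sets borel" "\<And>B. B \<in> sets borel \<Longrightarrow> B \<subseteq> A \<Longrightarrow> \<nu> B \<le> c" "0 \<le> c"
  shows "measure (pos_part \<nu>) A \<le> c"
  using emeasure_pos_part_le[OF assms(1,2)] assms(3) by (simp add: emeasure_eq_measure)

lemma le_measure_pos_part:
  assumes "A \<in> sets borel" "B \<in> sets borel" "B \<subseteq> A"
  shows "\<nu> B \<le> measure (pos_part \<nu>) A"
proof -
  have "ennreal (\<nu> B) \<le> emeasure (pos_part \<nu>) A"
    by (subst emeasure_pos_part[OF _ assms(1)])
       (use ca assms(2,3) in \<open>auto intro!: SUP_upper\<close>)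
  then show ?thesis
    by (simp add: emeasure_eq_measure)
qed

lemma integrable_pos_part: "integrable (pos_part \<nu>) (apply_bcontfun (g :: 'k \<Rightarrow>\<^sub>C real))"
proof (rule integrable_const_bound)
  show "AE x in pos_part \<nu>. norm (apply_bcontfun g x) \<le> norm g"
    by (intro AE_I2 norm_bounded)
  show "apply_bcontfun g \<in> borel_measurable (pos_part \<nu>)"
    by (subst measurable_cong_sets[OF sets_pos_part refl])
       (rule borel_measurable_continuous_onI, simp)
qed

lemma integral_pos_part_bound:
  "\<bar>integral\<^sup>L (pos_part \<nu>) (apply_bcontfun (g :: 'k \<Rightarrow>\<^sub>C real))\<bar> \<le> norm g"
proof -
  have "\<bar>integral\<^sup>L (pos_part \<nu>) (apply_bcontfun g)\<bar> \<le> (\<integral>x. \<bar>apply_bcontfun g x\<bar> \<partial>pos_part \<nu>)"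
    by (rule integral_abs_bound)
  also have "\<dots> \<le> (\<integral>x. norm g \<partial>pos_part \<nu>)"
    using integrable_pos_part norm_bounded[of g] by (intro integral_mono) auto
  also have "\<dots> = measure (pos_part \<nu>) UNIV * norm g"
    by simp
  also have "\<dots> \<le> 1 * norm g"
    using bound by (intro mult_right_mono measure_pos_part_least) (auto simp: abs_le_iff)
  finally show ?thesis
    by simp
qed

end

context
  fixes \<nu> :: "'k::topological_space set \<Rightarrow> real"
  assumes \<nu>: "\<nu> \<in> radon_ball"
begin

lemmas pos_hyps = radon_ball_countably_additive[OF \<nu>] radon_ball_abs_le_1[OF \<nu>]

lemma neg_hyps:
  "range A \<subseteq> sets borel \<Longrightarrow> disjoint_family A \<Longrightarrow> (\<lambda>i::nat. - \<nu> (A i)) sums (- \<nu> (\<Union>i. A i))"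
  "B \<in> sets borel \<Longrightarrow> \<bar>- \<nu> B\<bar> \<le> 1"
  using radon_ball_countably_additive[OF \<nu>] radon_ball_abs_le_1[OF \<nu>]
  by (auto intro: sums_minus)

lemma signed_integral_linear:
  "linear (\<lambda>g :: 'k \<Rightarrow>\<^sub>C real. signed_integral \<nu> (apply_bcontfun g))"
  using integrable_pos_part[OF pos_hyps] integrable_pos_part[OF neg_hyps]
  by (intro linearI) (auto simp: signed_integral_def algebra_simps)

text \<open>The constant is \<open>2\<close> since the positive and the negative part are each bounded by \<open>1\<close>; the optimal
  constant \<open>1\<close> would require that the two masses add up to the variation.\<close>

lemma signed_integral_bound:
  "\<bar>signed_integral \<nu> (apply_bcontfun (g :: 'k \<Rightarrow>\<^sub>C real))\<bar> \<le> 2 * norm g"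
  using integral_pos_part_bound[OF pos_hyps, of g] integral_pos_part_bound[OF neg_hyps, of g]
  unfolding signed_integral_def by linarith

text \<open>The identity \<open>\<nu>\<^sup>+(a) - \<nu>\<^sup>-(a) = \<nu>(a)\<close> holds because complementation in \<open>a\<close> matches the two
  suprema, since \<open>\<nu>(B) = \<nu>(a) - \<nu>(a - B)\<close> for \<open>B \<subseteq> a\<close>.\<close>

lemma signed_integral_clopen_indicator:
  assumes "a \<in> Clop"
  shows "signed_integral \<nu> (apply_bcontfun (clopen_indicator a)) = \<nu> a"
proof -
  have a: "a \<in> sets borel"
    using assms by (auto simp: Clop_def)
  define p where "p = measure (pos_part \<nu>) a"
  define q where "q = measure (pos_part (\<lambda>A. - \<nu> A)) a"
  have compl: "\<nu> a = \<nu> B + \<nu> (a - B)" if "B \<in> sets borel" "B \<subseteq> a" for B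
  proof -
    have "\<nu> (B \<union> (a - B)) = \<nu> B + \<nu> (a - B)"
      using radon_ball_additive[OF \<nu>] a that unfolding Measure_Space.additive_def by blast
    moreover have "B \<union> (a - B) = a"
      using that by auto
    ultimately show ?thesis
      by simp
  qed
  have p: "\<nu> B \<le> p" and q: "- \<nu> B \<le> q" if "B \<in> sets borel" "B \<subseteq> a" for B
    unfolding p_def q_def
    using le_measure_pos_part[OF pos_hyps a that] le_measure_pos_part[OF neg_hyps a that] by auto
  have "p \<le> q + \<nu> a"
    unfolding p_def
  proof (rule measure_pos_part_least[OF pos_hyps a])
    show "\<nu> B \<le> q + \<nu> a" if "B \<in> sets borel" "B \<subseteq> a" for B
      using compl[OF that] q[of "a - B"] that a by auto
  qed (use q[OF a] in auto)
  moreover have "q \<le> p - \<nu> a"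
    unfolding q_def
  proof (rule measure_pos_part_least[where \<nu> = "\<lambda>A. - \<nu> A", OF neg_hyps a])
    show "- \<nu> B \<le> p - \<nu> a" if "B \<in> sets borel" "B \<subseteq> a" for B
      using compl[OF that] p[of "a - B"] that a by auto
  qed (use p[OF a] in auto)
  ultimately have "p - q = \<nu> a"
    by simp
  then show ?thesis
    by (simp add: signed_integral_def clopen_indicator_apply[OF assms] p_def q_def)
qed

end

section \<open>Operators into the extension\<close>

text \<open>A uniformly bounded family of functionals, indexed by the points of a space, is an operator into
  its continuous functions as soon as the functions \<open>x \<mapsto> T x g\<close> are continuous. By the common bound, the
  \<open>g\<close> for which they are form a closed subspace, so clopen indicators suffice.\<close>

lemma bounded_operator_from_clopen_indicators:
  fixes T :: "'c::topological_space \<Rightarrow> ('k::t2_space \<Rightarrow>\<^sub>C real) \<Rightarrow> real"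
  assumes K: "compact (UNIV :: 'k set)" "topological_basis (Clop :: 'k set set)"
    and lin: "\<And>x. linear (T x)" and bound: "\<And>x g. \<bar>T x g\<bar> \<le> C * norm g"
    and cont: "\<And>a. a \<in> Clop \<Longrightarrow> continuous_on UNIV (\<lambda>x. T x (clopen_indicator a))"
  shows "\<exists>E :: ('k \<Rightarrow>\<^sub>C real) \<Rightarrow>\<^sub>L ('c \<Rightarrow>\<^sub>C real).
           \<forall>g x. apply_bcontfun (blinfun_apply E g) x = T x g"
proof -
  define V where "V = {g. continuous_on UNIV (\<lambda>x. T x g)}"
  have "g \<in> V" for g
  proof (rule closed_subspace_containing_clopen_indicators[OF K])
    show "subspace V"
      unfolding subspace_def V_def
      by (auto simp: linear_0[OF lin] linear_add[OF lin] linear_cmul[OF lin]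
          intro!: continuous_intros)
    show "closed V"
      unfolding closed_sequential_limits
    proof (intro allI impI, elim conjE)
      fix h g assume h: "\<forall>n::nat. h n \<in> V" and lim: "h \<longlonglongrightarrow> g"
      have "uniform_limit UNIV (\<lambda>n x. T x (h n)) (\<lambda>x. T x g) sequentially"
      proof (rule uniform_limitI)
        fix \<epsilon> :: real assume "0 < \<epsilon>"
        have "(\<lambda>n. C * norm (h n - g)) \<longlonglongrightarrow> C * 0"
          using lim by (intro tendsto_intros) (simp add: LIM_zero tendsto_norm_zero)
        then have "\<forall>\<^sub>F n in sequentially. C * norm (h n - g) < \<epsilon>"
          using \<open>0 < \<epsilon>\<close> by (intro order_tendstoD(2)[where y="C * 0"]) auto
        then show "\<forall>\<^sub>F n in sequentially. \<forall>x\<in>UNIV. dist (T x (h n)) (T x g) < \<epsilon>"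
        proof eventually_elim
          case (elim n)
          then show ?case
            using bound[of _ "h n - g"]
            by (auto simp: dist_real_def linear_diff[OF lin] intro: le_less_trans)
        qed
      qed
      then show "g \<in> V"
        unfolding V_def mem_Collect_eq
        by (rule uniform_limit_theorem[rotated]) (use h in \<open>auto simp: V_def\<close>)
    qed
    show "clopen_indicator a \<in> V" if "a \<in> Clop" for a
      using cont that by (simp add: V_def)
  qed
  then have "(\<lambda>x. T x g) \<in> bcontfun" for g
    using bound by (intro bcontfun_normI[where b="C * norm g"]) (auto simp: V_def)
  then have T_apply: "apply_bcontfun (Bcontfun (\<lambda>x. T x g)) x = T x g" for g x
    by (simp add: Bcontfun_inverse)
  have "bounded_linear (\<lambda>g. Bcontfun (\<lambda>x. T x g))"
  proof (rule bounded_linear_intro[where K=C])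
    show "norm (Bcontfun (\<lambda>x. T x g)) \<le> norm g * C" for g
      using bound by (intro norm_bound) (auto simp: T_apply mult.commute)
  qed (rule bcontfun_eqI, simp add: T_apply, simp add: linear_add[OF lin] linear_cmul[OF lin])+
  then show ?thesis
    by (intro exI[of _ "Blinfun (\<lambda>g. Bcontfun (\<lambda>x. T x g))"])
       (simp add: bounded_linear_Blinfun_apply T_apply)
qed

section \<open>Distance to the unit ball of finitely additive functions\<close>

lemma zero_in_fa_ball: "(\<lambda>_. 0) \<in> fa_ball X M"
  by (auto simp: fa_ball_def fa_measures_def Measure_Space.additive_def variation_def
      intro!: SUP_least le_less_trans[OF _ ennreal_zero_less_top])

text \<open>The real infimum and the supremum inside \<open>dist_on\<close> behave as intended only because the ball contains
  \<open>0\<close> and \<open>\<BB>\<close> is finite and nonempty.\<close>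

lemma INF_dist_on_tendsto_zero:
  assumes \<BB>: "finite \<BB>" "\<BB> \<noteq> {}"
    and near: "\<And>\<epsilon>. 0 < \<epsilon> \<Longrightarrow>
      \<forall>\<^sub>F n in sequentially. \<exists>\<mu>\<in>fa_ball X M. \<forall>b\<in>\<BB>. \<bar>\<mu> b - \<phi> n b\<bar> < \<epsilon>"
  shows "(\<lambda>n. INF \<mu>\<in>fa_ball X M. dist_on \<BB> \<mu> (\<phi> n)) \<longlonglongrightarrow> 0"
proof -
  have nonneg: "0 \<le> dist_on \<BB> \<mu> \<psi>" for \<mu> \<psi>
  proof -
    obtain b where "b \<in> \<BB>"
      using \<open>\<BB> \<noteq> {}\<close> by auto
    then have "\<bar>\<mu> b - \<psi> b\<bar> \<le> dist_on \<BB> \<mu> \<psi>"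
      unfolding dist_on_def using \<open>finite \<BB>\<close> by (intro cSUP_upper bdd_above_finite) auto
    then show ?thesis
      by linarith
  qed
  have INF_nonneg: "0 \<le> (INF \<mu>\<in>fa_ball X M. dist_on \<BB> \<mu> (\<phi> n))" for n
    using nonneg zero_in_fa_ball[of X M] by (intro cINF_greatest) blast+
  show ?thesis
  proof (rule order_tendstoI)
    show "\<forall>\<^sub>F n in sequentially. c < (INF \<mu>\<in>fa_ball X M. dist_on \<BB> \<mu> (\<phi> n))" if "c < 0" for c
      using less_le_trans[OF that INF_nonneg] by simp
  next
    fix c :: real assume "0 < c"
    then have "0 < c/2"
      by simp
    from near[OF this]
    show "\<forall>\<^sub>F n in sequentially. (INF \<mu>\<in>fa_ball X M. dist_on \<BB> \<mu> (\<phi> n)) < c"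
    proof eventually_elim
      case (elim n)
      then obtain \<mu> where \<mu>: "\<mu> \<in> fa_ball X M" "\<And>b. b \<in> \<BB> \<Longrightarrow> \<bar>\<mu> b - \<phi> n b\<bar> < c/2"
        by blast
      have "(INF \<mu>\<in>fa_ball X M. dist_on \<BB> \<mu> (\<phi> n)) \<le> dist_on \<BB> \<mu> (\<phi> n)"
        using \<mu>(1) nonneg by (intro cINF_lower bdd_belowI2[where m=0])
      also have "\<dots> \<le> c/2"
        unfolding dist_on_def using \<mu>(2) \<open>\<BB> \<noteq> {}\<close> by (intro cSUP_least less_imp_le)
      finally show ?case
        using \<open>0 < c\<close> by linarith
    qed
  qed
qed

section \<open>Countable discrete extensions of the dual ball\<close>

lemma topspace_weak_star_ball [simp]: "topspace weak_star_ball = radon_ball"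
  by (auto simp: weak_star_ball_def topspace_pullback_topology)

lemma closed_image_radon_ball:
  fixes e :: "('k::t2_space set \<Rightarrow> real) \<Rightarrow> 'c::t2_space"
  assumes "countable_discrete_extension weak_star_ball e"
  shows "closed (e ` radon_ball)"
proof -
  have "homeomorphic_map weak_star_ball (subtopology euclidean (e ` radon_ball)) e"
    and "compactin weak_star_ball (radon_ball :: ('k set \<Rightarrow> real) set)"
    using assms by (simp_all add: countable_discrete_extension_def embedding_map_def compact_space_def)
  then have "compactin (subtopology euclidean (e ` radon_ball)) (e ` radon_ball)"
    using homeomorphic_imp_continuous_map image_compactin by blast
  then show ?thesis
    by (simp add: compactin_subtopology compact_imp_closed)
qed

text \<open>A point of \<open>L' - L\<close> is isolated in all of \<open>L'\<close>, because \<open>L\<close> is compact and so its complement is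
  open.\<close>

lemma isolated_off_radon_ball:
  fixes e :: "('k::t2_space set \<Rightarrow> real) \<Rightarrow> 'c::t2_space"
  assumes ext: "countable_discrete_extension weak_star_ball e" and x: "x \<notin> e ` radon_ball"
  shows "open {x}"
proof -
  have "discrete (UNIV - e ` (radon_ball :: ('k set \<Rightarrow> real) set))"
    using ext by (simp add: countable_discrete_extension_def)
  from discreteD[OF this, of x] x
  have "x isolated_in (UNIV - e ` (radon_ball :: ('k set \<Rightarrow> real) set))"
    by simp
  then obtain T where "open T" "T \<inter> (UNIV - e ` (radon_ball :: ('k set \<Rightarrow> real) set)) = {x}"
    by (rule isolated_inE)
  moreover have "open (UNIV - e ` (radon_ball :: ('k set \<Rightarrow> real) set))"
    using closed_image_radon_ball[OF ext] by (simp add: open_Diff)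
  ultimately show ?thesis
    by (metis open_Int)
qed

lemma finite_if_closed_off_radon_ball:
  fixes e :: "('k::t2_space set \<Rightarrow> real) \<Rightarrow> 'c::t2_space"
  assumes ext: "countable_discrete_extension weak_star_ball e"
    and A: "closed A" "A \<inter> e ` radon_ball = {}"
  shows "finite A"
proof -
  have "compact (UNIV :: 'c set)"
    using ext by (simp add: countable_discrete_extension_def)
  from compact_Int_closed[OF this A(1)] have "compact A"
    by simp
  moreover have "discrete A"
    unfolding discrete_def
  proof
    fix x assume "x \<in> A"
    then have "open {x}"
      using A(2) by (intro isolated_off_radon_ball[OF ext]) blast
    then show "x isolated_in A"
      using \<open>x \<in> A\<close> by (auto simp: isolated_in_def)
  qed
  ultimately show ?thesis
    using discrete_compact_finite_iff by blast
qed

text \<open>Evaluation at a clopen set is the integral of a continuous function, hence weak* continuous. It is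
  transported along the embedding to the closed subset \<open>L\<close> of the normal space \<open>L'\<close> and extended there.\<close>

lemma clopen_values_extend:
  fixes e :: "('k::t2_space set \<Rightarrow> real) \<Rightarrow> 'c::t2_space"
  assumes "countable_discrete_extension weak_star_ball e" "a \<in> Clop"
  shows "\<exists>f. continuous_on UNIV f \<and> range f \<subseteq> {-1..1} \<and> (\<forall>\<nu>\<in>radon_ball. f (e \<nu>) = \<nu> a)"
proof -
  let ?L = "e ` (radon_ball :: ('k set \<Rightarrow> real) set)"
  have "homeomorphic_map weak_star_ball (subtopology euclidean ?L) e"
    using assms by (simp add: countable_discrete_extension_def embedding_map_def)
  then obtain e' where e': "homeomorphic_maps weak_star_ball (subtopology euclidean ?L) e e'"
    by (auto simp: homeomorphic_map_maps)
  have e'e: "e' (e \<nu>) = \<nu>" if "\<nu> \<in> radon_ball" for \<nu>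
    using e' that by (simp add: homeomorphic_maps_def)
  have "continuous_map weak_star_ball euclideanreal
      ((\<lambda>h. h (clopen_indicator a)) \<circ> (\<lambda>\<nu> g. signed_integral \<nu> (apply_bcontfun g)))"
    unfolding weak_star_ball_def
    by (intro continuous_map_pullback continuous_map_product_projection) auto
  then have "continuous_map weak_star_ball euclideanreal (\<lambda>\<nu>. \<nu> a)"
    by (rule continuous_map_eq)
       (use assms in \<open>auto simp: signed_integral_clopen_indicator\<close>)
  moreover have "continuous_map (subtopology euclidean ?L) weak_star_ball e'"
    using e' by (simp add: homeomorphic_maps_def)
  ultimately have "continuous_map (subtopology euclidean ?L) euclideanreal ((\<lambda>\<nu>. \<nu> a) \<circ> e')"
    by (rule continuous_map_compose[rotated])
  then have cont: "continuous_map (subtopology euclidean ?L) euclideanreal (\<lambda>x. e' x a)"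
    by (simp add: o_def)
  have closed: "closedin euclidean ?L"
    using closed_image_radon_ball[OF assms(1)] by simp
  have "Hausdorff_space (euclidean :: 'c topology)"
    unfolding Hausdorff_space_def disjnt_def using hausdorff by (simp, blast)
  then have normal: "normal_space (euclidean :: 'c topology)"
    using assms
    by (intro compact_Hausdorff_or_regular_imp_normal_space)
       (auto simp: compact_space_def countable_discrete_extension_def)
  have range: "(\<lambda>x. e' x a) ` ?L \<subseteq> {-1..1}"
    using assms radon_ball_abs_le_1 e'e by (fastforce simp: Clop_def abs_le_iff)
  obtain f where "continuous_map euclidean euclideanreal f"
      "\<And>x. x \<in> ?L \<Longrightarrow> f x = e' x a" "f ` topspace euclidean \<subseteq> {-1..1}"
    by (rule Tietze_extension_closed_real_interval[OF normal closed cont range]) auto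
  then show ?thesis
    using e'e by (intro exI[of _ f]) auto
qed

text \<open>Near \<open>e \<nu>\<close> the finitely many functions \<open>f b\<close> are close to the values \<open>\<nu> b\<close>, so the exceptional set is
  closed and misses \<open>L\<close>; a closed set inside the discrete remainder is finite.\<close>

lemma extended_values_near_ball:
  fixes e :: "('k::t2_space set \<Rightarrow> real) \<Rightarrow> 'c::t2_space"
  assumes ext: "countable_discrete_extension weak_star_ball e"
    and f: "\<And>a. a \<in> \<BB> \<Longrightarrow> continuous_on UNIV (f a)"
      "\<And>a \<nu>. a \<in> \<BB> \<Longrightarrow> \<nu> \<in> radon_ball \<Longrightarrow> f a (e \<nu>) = \<nu> a"
    and "finite \<BB>" "0 < \<epsilon>"
  shows "finite {x. \<not> (\<exists>\<nu>\<in>radon_ball. \<forall>b\<in>\<BB>. \<bar>\<nu> b - f b x\<bar> < \<epsilon>)}"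
proof (rule finite_if_closed_off_radon_ball[OF ext])
  define U where "U \<nu> = (\<Inter>b\<in>\<BB>. {x. \<bar>\<nu> b - f b x\<bar> < \<epsilon>})" for \<nu>
  have eq: "{x. \<not> (\<exists>\<nu>\<in>radon_ball. \<forall>b\<in>\<BB>. \<bar>\<nu> b - f b x\<bar> < \<epsilon>)} = - (\<Union>\<nu>\<in>radon_ball. U \<nu>)"
    by (auto simp: U_def)
  have "open (U \<nu>)" for \<nu>
    unfolding U_def
  proof (intro open_INT \<open>finite \<BB>\<close> ballI open_Collect_less)
    show "continuous_on UNIV (\<lambda>x. \<bar>\<nu> b - f b x\<bar>)" if "b \<in> \<BB>" for b
      using f(1)[OF that] by (intro continuous_intros)
  qed simp
  then show "closed {x. \<not> (\<exists>\<nu>\<in>radon_ball. \<forall>b\<in>\<BB>. \<bar>\<nu> b - f b x\<bar> < \<epsilon>)}"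
    unfolding eq by (intro closed_Compl open_UN) auto
  have "e \<nu> \<in> U \<nu>" if "\<nu> \<in> radon_ball" for \<nu>
    using that f(2) \<open>0 < \<epsilon>\<close> by (auto simp: U_def)
  then show "{x. \<not> (\<exists>\<nu>\<in>radon_ball. \<forall>b\<in>\<BB>. \<bar>\<nu> b - f b x\<bar> < \<epsilon>)} \<inter> e ` radon_ball = {}"
    unfolding eq by auto
qed

text \<open>Continuity at a point outside \<open>D\<close> holds because removing the finitely many points where \<open>d\<close> is
  large leaves a neighbourhood.\<close>

lemma continuous_if_vanishing_along_isolated_points:
  fixes d :: "'c::t2_space \<Rightarrow> real"
  assumes isolated: "\<And>x. x \<in> D \<Longrightarrow> open {x}"
    and zero: "\<And>x. x \<notin> D \<Longrightarrow> d x = 0"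
    and small: "\<And>\<epsilon>. 0 < \<epsilon> \<Longrightarrow> finite {x\<in>D. \<epsilon> \<le> \<bar>d x\<bar>}"
  shows "continuous_on UNIV d"
proof -
  have "isCont d x" for x
  proof (cases "x \<in> D")
    case True
    then have "at x = bot"
      using isolated at_eq_bot_iff[of x] by simp
    then show ?thesis
      by (simp add: isCont_def)
  next
    case False
    have "(d \<longlongrightarrow> 0) (at x)"
    proof (rule tendstoI)
      fix \<epsilon> :: real assume "0 < \<epsilon>"
      have "open (- {x\<in>D. \<epsilon> \<le> \<bar>d x\<bar>})"
        using small[OF \<open>0 < \<epsilon>\<close>] by (intro open_Compl finite_imp_closed)
      then have "\<forall>\<^sub>F y in at x. y \<in> - {x\<in>D. \<epsilon> \<le> \<bar>d x\<bar>}"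
        using False by (intro eventually_at_in_open') auto
      then show "\<forall>\<^sub>F y in at x. dist (d y) 0 < \<epsilon>"
      proof eventually_elim
        case (elim y)
        then show ?case
          using zero[of y] \<open>0 < \<epsilon>\<close> by (cases "y \<in> D") auto
      qed
    qed
    then show ?thesis
      using zero[OF False] by (simp add: isCont_def)
  qed
  then show ?thesis
    by (simp add: continuous_at_imp_continuous_on)
qed

section \<open>The approximation property implies the *extension property\<close>

theorem theorem5p1:
  assumes "compact (UNIV :: 'k::t2_space set)"
    and "topological_basis (Clop :: 'k set set)"
    and "approximation_property UNIV (Clop :: 'k set set)"
  shows "star_extension_property TYPE('k) TYPE('c::t2_space)"
  unfolding star_extension_property_def
proof (intro allI impI)
  fix e :: "('k set \<Rightarrow> real) \<Rightarrow> 'c"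
  assume ext: "countable_discrete_extension weak_star_ball e"
  define D where "D = UNIV - e ` (radon_ball :: ('k set \<Rightarrow> real) set)"
  have inj: "inj_on e radon_ball" and "countable D"
    using ext homeomorphic_imp_injective_map[of weak_star_ball "subtopology euclidean (e ` radon_ball)" e]
    by (simp_all add: countable_discrete_extension_def embedding_map_def D_def)
  then obtain i :: "'c \<Rightarrow> nat" where i: "inj_on i D"
    by (auto simp: countable_def)
  have "\<forall>a\<in>Clop. \<exists>f. continuous_on UNIV f \<and> range f \<subseteq> {-1..1} \<and> (\<forall>\<nu>\<in>radon_ball. f (e \<nu>) = \<nu> a)"
    using clopen_values_extend[OF ext] by blast
  from bchoice[OF this] obtain f where f_all: "\<forall>a\<in>Clop. continuous_on UNIV (f a) \<and>
      range (f a) \<subseteq> {-1..1} \<and> (\<forall>\<nu>\<in>radon_ball. f a (e \<nu>) = \<nu> a)"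
    by (elim exE)
  have f: "\<And>a. a \<in> Clop \<Longrightarrow> continuous_on UNIV (f a)"
      "\<And>a. a \<in> Clop \<Longrightarrow> range (f a) \<subseteq> {-1..1}"
      "\<And>a \<nu>. a \<in> Clop \<Longrightarrow> \<nu> \<in> radon_ball \<Longrightarrow> f a (e \<nu>) = \<nu> a"
    using f_all by simp_all
  \<comment> \<open>The points of \<open>D\<close> are enumerated by an injection into \<open>\<nat>\<close> rather than by a sequence, so that finite
      and infinite \<open>D\<close> are treated alike. At the unused indices the value \<open>0\<close> is that of the zero measure.\<close>
  define \<phi> where "\<phi> n a = (if n \<in> i ` D then f a (inv_into D i n) else 0)" for n a
  have \<phi>_i: "\<phi> (i x) a = f a x" if "x \<in> D" for x a
    using that i by (simp add: \<phi>_def)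
  have approx: "(\<lambda>n. INF \<mu>\<in>fa_ball UNIV Clop. dist_on \<BB> \<mu> (\<phi> n)) \<longlonglongrightarrow> 0"
    if \<BB>: "\<BB> \<subseteq> Clop" "finite \<BB>" "algebra UNIV \<BB>" for \<BB> :: "'k set set"
  proof (rule INF_dist_on_tendsto_zero)
    show "\<BB> \<noteq> {}"
      using algebra.top[OF \<BB>(3)] by auto
    fix \<epsilon> :: real assume "0 < \<epsilon>"
    define Bad where "Bad = {x. \<not> (\<exists>\<nu>\<in>radon_ball. \<forall>b\<in>\<BB>. \<bar>\<nu> b - f b x\<bar> < \<epsilon>)}"
    have "finite Bad"
      unfolding Bad_def using \<BB> f(1,3) \<open>0 < \<epsilon>\<close>
      by (intro extended_values_near_ball[OF ext]) (auto simp: subset_iff)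
    then have "\<forall>\<^sub>F n in sequentially. n \<notin> i ` Bad"
      using infinite_nat_iff_unbounded_le eventually_sequentially by (metis finite_imageI)
    then show "\<forall>\<^sub>F n in sequentially. \<exists>\<mu>\<in>fa_ball UNIV Clop. \<forall>b\<in>\<BB>. \<bar>\<mu> b - \<phi> n b\<bar> < \<epsilon>"
    proof eventually_elim
      case (elim n)
      show ?case
      proof (cases "n \<in> i ` D")
        case True
        then obtain x where x: "x \<in> D" "n = i x"
          by auto
        then have "x \<notin> Bad"
          using elim by auto
        then obtain \<nu> where "\<nu> \<in> radon_ball" "\<forall>b\<in>\<BB>. \<bar>\<nu> b - f b x\<bar> < \<epsilon>"
          by (auto simp: Bad_def)
        then show ?thesis
          using x \<phi>_i by (intro bexI[of _ \<nu>]) (simp_all add: radon_ball_imp_fa_ball)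
      next
        case False
        then show ?thesis
          using \<open>0 < \<epsilon>\<close> by (intro bexI[OF _ zero_in_fa_ball]) (simp add: \<phi>_def)
      qed
    qed
  qed (fact \<BB>(2))
  have "\<forall>n. \<forall>a\<in>Clop. \<phi> n a \<in> {-1..1}"
    using f(2) by (auto simp: \<phi>_def subset_iff image_subset_iff)
  with assms(3) approx have "\<exists>\<mu>. (\<forall>n. \<mu> n \<in> fa_measures UNIV (Clop :: 'k set set)) \<and>
      (\<exists>C. \<forall>n. variation Clop (\<mu> n) UNIV \<le> ennreal C) \<and>
      (\<forall>a\<in>Clop. (\<lambda>n. \<phi> n a - \<mu> n a) \<longlonglongrightarrow> 0)"
    unfolding approximation_property_def by simp
  then obtain \<mu> C' where \<mu>: "\<And>n. \<mu> n \<in> fa_measures UNIV (Clop :: 'k set set)"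
      "\<And>n. variation Clop (\<mu> n) UNIV \<le> ennreal C'"
      "\<And>a. a \<in> Clop \<Longrightarrow> (\<lambda>n. \<phi> n a - \<mu> n a) \<longlonglongrightarrow> 0"
    by auto
  \<comment> \<open>a common bound for the integrals against the \<open>\<mu> n\<close> and for those against members of the ball; it is
      nonnegative, while \<open>C'\<close> may be negative as \<open>ennreal\<close> truncates\<close>
  define C where "C = max 2 C'"
  have "0 \<le> C"
    by (simp add: C_def)
  have "variation Clop (\<mu> n) UNIV \<le> ennreal C" for n
    using \<mu>(2)[of n] by (rule order_trans) (simp add: C_def ennreal_leI)
  then have "\<exists>\<Lambda> :: ('k \<Rightarrow>\<^sub>C real) \<Rightarrow> real. linear \<Lambda> \<and> (\<forall>g. \<bar>\<Lambda> g\<bar> \<le> C * norm g) \<and>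
           (\<forall>a\<in>Clop. \<Lambda> (clopen_indicator a) = \<mu> n a)" for n
    using \<mu>(1)[of n] \<open>0 \<le> C\<close>
    by (intro fa_integral_exists[OF assms(1,2)]) (auto simp: fa_measures_def)
  then obtain \<Lambda> :: "nat \<Rightarrow> ('k \<Rightarrow>\<^sub>C real) \<Rightarrow> real" where \<Lambda>: "\<And>n. linear (\<Lambda> n)"
      "\<And>n g. \<bar>\<Lambda> n g\<bar> \<le> C * norm g" "\<And>n a. a \<in> Clop \<Longrightarrow> \<Lambda> n (clopen_indicator a) = \<mu> n a"
    by metis
  define T where "T x = (if x \<in> D then \<Lambda> (i x)
      else (\<lambda>g. signed_integral (inv_into radon_ball e x) (apply_bcontfun g)))" for x
  have inv_ball: "inv_into radon_ball e x \<in> radon_ball" if "x \<notin> D" for x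
    using that by (auto simp: D_def inv_into_into)
  have T_e: "T (e \<nu>) g = signed_integral \<nu> (apply_bcontfun g)" if "\<nu> \<in> radon_ball" for \<nu> g
    using that inj by (simp add: T_def D_def)
  have "\<exists>E :: ('k \<Rightarrow>\<^sub>C real) \<Rightarrow>\<^sub>L ('c \<Rightarrow>\<^sub>C real). \<forall>g x. apply_bcontfun (blinfun_apply E g) x = T x g"
  proof (rule bounded_operator_from_clopen_indicators[OF assms(1,2)])
    show "linear (T x)" for x
      using \<Lambda>(1) signed_integral_linear[OF inv_ball] by (simp add: T_def)
    show "\<bar>T x g\<bar> \<le> C * norm g" for x g
    proof (cases "x \<in> D")
      case False
      have "\<bar>T x g\<bar> \<le> 2 * norm g"
        using signed_integral_bound[OF inv_ball[OF False]] False by (simp add: T_def)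
      also have "\<dots> \<le> C * norm g"
        by (intro mult_right_mono) (auto simp: C_def)
      finally show ?thesis .
    qed (use \<Lambda>(2) in \<open>simp add: T_def\<close>)
  next
    fix a :: "'k set" assume a: "a \<in> Clop"
    \<comment> \<open>\<open>f a\<close> is continuous and has the same values on \<open>L\<close>, so continuity of \<open>x \<mapsto> T x 1\<^sub>a\<close> is that of
        a function vanishing on \<open>L\<close>\<close>
    define d where "d x = T x (clopen_indicator a) - f a x" for x
    have d_D: "\<bar>d x\<bar> = \<bar>\<phi> (i x) a - \<mu> (i x) a\<bar>" if "x \<in> D" for x
      using that \<Lambda>(3)[OF a] by (simp add: d_def T_def \<phi>_i abs_minus_commute)
    have d_L: "d x = 0" if x: "x \<notin> D" for x
    proof -
      obtain \<nu> where "\<nu> \<in> radon_ball" "x = e \<nu>"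
        using x by (auto simp: D_def)
      then show ?thesis
        using a by (simp add: d_def T_e f(3) signed_integral_clopen_indicator)
    qed
    have "continuous_on UNIV d"
    proof (rule continuous_if_vanishing_along_isolated_points)
      show "open {x}" if "x \<in> D" for x
        using that by (intro isolated_off_radon_ball[OF ext]) (simp add: D_def)
      fix \<epsilon> :: real assume "0 < \<epsilon>"
      then obtain N where N: "\<And>n. N \<le> n \<Longrightarrow> \<bar>\<phi> n a - \<mu> n a\<bar> < \<epsilon>"
        using LIMSEQ_D[OF \<mu>(3)[OF a]] by auto
      have "i ` {x\<in>D. \<epsilon> \<le> \<bar>d x\<bar>} \<subseteq> {..<N}"
      proof
        fix n assume "n \<in> i ` {x\<in>D. \<epsilon> \<le> \<bar>d x\<bar>}"
        then obtain x where "x \<in> D" "n = i x" "\<epsilon> \<le> \<bar>d x\<bar>"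
          by blast
        then have "\<epsilon> \<le> \<bar>\<phi> n a - \<mu> n a\<bar>"
          using d_D[of x] by simp
        then show "n \<in> {..<N}"
          using N[of n] by (cases "N \<le> n") auto
      qed
      then have "finite (i ` {x\<in>D. \<epsilon> \<le> \<bar>d x\<bar>})"
        using finite_subset by blast
      then show "finite {x\<in>D. \<epsilon> \<le> \<bar>d x\<bar>}"
        by (rule finite_imageD) (rule inj_on_subset[OF i], auto)
    qed (rule d_L)
    then have "continuous_on UNIV (\<lambda>x. d x + f a x)"
      using f(1)[OF a] by (intro continuous_intros)
    then show "continuous_on UNIV (\<lambda>x. T x (clopen_indicator a))"
      by (simp add: d_def)
  qed
  then show "\<exists>E :: ('k \<Rightarrow>\<^sub>C real) \<Rightarrow>\<^sub>L ('c \<Rightarrow>\<^sub>C real). \<forall>g. \<forall>\<nu>\<in>radon_ball.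
      apply_bcontfun (blinfun_apply E g) (e \<nu>) = signed_integral \<nu> (apply_bcontfun g)"
    using T_e by metis
qed

end
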